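(* Let $V$ be an ordered real vector space with positive cone $V_+$, let $E\subseteq V_+$ be a cone, let $m\in\mathbb{N}$, and let $f:E\to[0,\infty]^m$ be a map. Consider the statements: (a) $f$ is positively homogeneous, i.e. $f(\lambda x)=\lambda f(x)$ for all $x\in E$ and $\lambda\in(0,\infty)$; (b) the epigraph $\operatorname{epi}(f)$ is a cone; (c) the geometric epigraph $\operatorname{epi}^{G}(f)$ is a cone. Then (a) implies (b), and (b) is equivalent to (c). If moreover $m=1$, or $f$ takes values in $[0,\infty)^m$, then (b) implies (a).
   Context: An ordered vector space is a real vector space $V$ with a partial order $\le$ such that $x\le y$ implies $\alpha x+z\le\alpha y+z$ for all $z\in V$, $\alpha\in[0,\infty)$; $V_+=\{x\in V: 0\le x\}$. A subset $C$ of a vector space is a cone if $\lambda C\subseteq C$ for all $\lambda\in(0,\infty)$. $\mathbb{R}^m$ and $[0,\infty]^m$ carry the componentwise order, and $\lambda\cdot\infty=\infty$ for $\lambda>0$. For $f:E\to[0,\infty]^m$: $\operatorname{epi}(f)=\{(x,\alpha)\in E\times\mathbb{R}^m: f(x)\le\alpha\}$ and $\operatorname{epi}^G(f)=\{(x,\alpha)\in E\times(0,\infty)^m: f(x)\le\alpha\}$. *)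

theory Defs
  imports "HOL-Analysis.Analysis"
begin

text \<open>
  Cones are closed under multiplication by strictly positive scalars only, so the origin need
  not belong to a cone. This is weaker than the library's \<^term>\<open>cone\<close> and \<^term>\<open>conic\<close>, which
  also allow the scalar \<open>0\<close>.
\<close>

definition is_cone :: "'a::real_vector set \<Rightarrow> bool" where
  "is_cone C \<longleftrightarrow> (\<forall>l::real. 0 < l \<longrightarrow> (\<lambda>x. l *\<^sub>R x) ` C \<subseteq> C)"

text \<open>
  A map \<open>E \<rightarrow> [0,\<infinity>]\<^sup>m\<close> is a total function into \<^typ>\<open>ennreal ^ 'm\<close> of which only the values on
  \<open>E\<close> are used.
\<close>

definition positively_homogeneous_on ::
    "'a::real_vector set \<Rightarrow> ('a \<Rightarrow> ennreal ^ 'm) \<Rightarrow> bool" where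
  "positively_homogeneous_on E f \<longleftrightarrow>
     (\<forall>x\<in>E. \<forall>l::real. 0 < l \<longrightarrow> f (l *\<^sub>R x) = ennreal l *s f x)"

text \<open>
  The inequality \<open>f x \<le> \<alpha>\<close> between an element of \<open>[0,\<infinity>]\<^sup>m\<close> and an element of \<open>\<real>\<^sup>m\<close> is taken
  componentwise in the extended reals. Comparing in \<^typ>\<open>ennreal\<close> would be wrong, since the
  coercion \<^term>\<open>ennreal\<close> sends negative reals to \<open>0\<close>.
\<close>

definition epi :: "'a set \<Rightarrow> ('a \<Rightarrow> ennreal ^ 'm) \<Rightarrow> ('a \<times> (real ^ 'm)) set" where
  "epi E f = {(x, \<alpha>). x \<in> E \<and> (\<forall>i. enn2ereal (f x $ i) \<le> ereal (\<alpha> $ i))}"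

definition geometric_epi :: "'a set \<Rightarrow> ('a \<Rightarrow> ennreal ^ 'm) \<Rightarrow> ('a \<times> (real ^ 'm)) set" where
  "geometric_epi E f =
     {(x, \<alpha>). x \<in> E \<and> (\<forall>i. 0 < \<alpha> $ i) \<and> (\<forall>i. enn2ereal (f x $ i) \<le> ereal (\<alpha> $ i))}"

end

theory Submission imports Defs begin

text \<open>Scaling by l > 0 preserves the order, so homogeneity carries points of the epigraph to
  points of the epigraph. The two epigraphs differ only in boundary points, which are recovered by
  letting a positive perturbation tend to 0 (\<open>is_cone_epi_if_geometric\<close>). To get back
  to homogeneity (\<open>positively_homogeneous_on_if_is_cone_epi\<close>), scale the lowest point
  (x, f x) of the epigraph above x: this gives f (l x) \<le> l f x, and the same inequality for l x
  and 1/l gives the converse. It requires f x to be a real vector, or else infinite in every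
  coordinate, where the bound is trivial.\<close>

lemma is_coneD: "is_cone C \<Longrightarrow> x \<in> C \<Longrightarrow> 0 < l \<Longrightarrow> l *\<^sub>R x \<in> C"
  unfolding is_cone_def by blast

text \<open>Moves the epigraph inequality into \<open>ennreal\<close>, where the scaling takes
  place; the sign condition restores what truncation by \<open>ennreal\<close> forgets.\<close>

lemma enn2ereal_le_ereal_iff: "enn2ereal a \<le> ereal r \<longleftrightarrow> 0 \<le> r \<and> a \<le> ennreal r"
proof
  assume h: "enn2ereal a \<le> ereal r"
  have "0 \<le> enn2ereal a"
    by simp
  with h have "0 \<le> ereal r"
    by (rule order_trans[rotated])
  then show "0 \<le> r \<and> a \<le> ennreal r"
    using h by (simp add: less_eq_ennreal.rep_eq enn2ereal_ennreal)
next
  assume "0 \<le> r \<and> a \<le> ennreal r"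
  then show "enn2ereal a \<le> ereal r"
    by (auto simp: less_eq_ennreal.rep_eq enn2ereal_ennreal)
qed

lemma mem_epi_iff:
  "(x, \<alpha>) \<in> epi E f \<longleftrightarrow> x \<in> E \<and> (\<forall>i. 0 \<le> \<alpha> $ i \<and> f x $ i \<le> ennreal (\<alpha> $ i))"
  by (simp add: epi_def enn2ereal_le_ereal_iff)

lemma geometric_epi_eq: "geometric_epi E f = epi E f \<inter> {(x, \<alpha>). \<forall>i. 0 < \<alpha> $ i}"
  by (auto simp: geometric_epi_def epi_def)

lemma is_cone_epi:
  assumes "is_cone E" and hom: "positively_homogeneous_on E f"
  shows "is_cone (epi E f)"
  unfolding is_cone_def
proof (intro allI impI image_subsetI)
  fix l :: real and p
  assume l: "0 < l" and "p \<in> epi E f"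
  then obtain x \<alpha> where p: "p = (x, \<alpha>)" and x: "x \<in> E"
    and \<alpha>: "\<And>i. 0 \<le> \<alpha> $ i" "\<And>i. f x $ i \<le> ennreal (\<alpha> $ i)"
    by (cases p) (auto simp: mem_epi_iff)
  have "f (l *\<^sub>R x) $ i \<le> ennreal (l * \<alpha> $ i)" for i
    using hom x l \<alpha> by (simp add: positively_homogeneous_on_def ennreal_mult mult_left_mono)
  with is_coneD[OF assms(1) x l] \<alpha> l show "l *\<^sub>R p \<in> epi E f"
    by (simp add: p mem_epi_iff)
qed

text \<open>The strictly positive orthant is stable under positive scaling, hence so is its
  intersection with a cone.\<close>

lemma is_cone_geometric_epi:
  assumes "is_cone (epi E f)"
  shows "is_cone (geometric_epi E f)"
  using is_coneD[OF assms] by (fastforce simp: is_cone_def geometric_epi_eq)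

text \<open>
  A point of the epigraph is approximated by the points with \<open>\<epsilon>\<close> added to every coordinate of
  the second component, which lie in the geometric epigraph.
\<close>

lemma is_cone_epi_if_geometric:
  fixes f :: "'a::real_vector \<Rightarrow> ennreal ^ 'm"
  assumes "is_cone E" and cone: "is_cone (geometric_epi E f)"
  shows "is_cone (epi E f)"
  unfolding is_cone_def
proof (intro allI impI image_subsetI)
  fix l :: real and p
  assume l: "0 < l" and "p \<in> epi E f"
  then obtain x \<alpha> where p: "p = (x, \<alpha>)" and x: "x \<in> E"
    and \<alpha>: "\<And>i. 0 \<le> \<alpha> $ i" "\<And>i. f x $ i \<le> ennreal (\<alpha> $ i)"
    by (cases p) (auto simp: mem_epi_iff)
  have "f (l *\<^sub>R x) $ i \<le> ennreal (l * \<alpha> $ i)" for i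
  proof (rule ennreal_le_epsilon)
    fix e :: real
    assume e: "0 < e"
    \<comment> \<open>The shift is \<open>e / l\<close> so that scaling by \<open>l\<close> turns it
      into exactly \<open>e\<close>.\<close>
    define \<beta> :: "real ^ 'm" where "\<beta> = (\<chi> i. \<alpha> $ i + e / l)"
    have \<beta>: "0 < \<beta> $ i" "f x $ i \<le> ennreal (\<beta> $ i)" for i
      using \<alpha>[of i] e l
      by (auto simp: \<beta>_def add_nonneg_pos add_increasing2)
    then have "(x, \<beta>) \<in> geometric_epi E f"
      using x by (simp add: geometric_epi_eq mem_epi_iff less_imp_le)
    from is_coneD[OF cone this l] have "f (l *\<^sub>R x) $ i \<le> ennreal (l * \<beta> $ i)"
      by (simp add: geometric_epi_eq mem_epi_iff)
    also have "l * \<beta> $ i = l * \<alpha> $ i + e"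
      using l by (simp add: \<beta>_def field_simps)
    also have "ennreal \<dots> = ennreal (l * \<alpha> $ i) + ennreal e"
      using \<alpha>(1)[of i] l e by (intro ennreal_plus) auto
    finally show "f (l *\<^sub>R x) $ i \<le> ennreal (l * \<alpha> $ i) + ennreal e" .
  qed
  with is_coneD[OF assms(1) x l] \<alpha> l show "l *\<^sub>R p \<in> epi E f"
    by (simp add: p mem_epi_iff)
qed

text \<open>
  The hypothesis on \<open>f\<close> excludes values with both finite and infinite components, above which the
  epigraph is empty and hence carries no information on the finite components.
\<close>

lemma positively_homogeneous_on_if_is_cone_epi:
  fixes f :: "'a::real_vector \<Rightarrow> ennreal ^ 'm"
  assumes "is_cone E" and cone: "is_cone (epi E f)"
    and pure: "\<And>x. x \<in> E \<Longrightarrow> (\<forall>i. f x $ i < \<infinity>) \<or> (\<forall>i. f x $ i = \<infinity>)"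
  shows "positively_homogeneous_on E f"
proof -
  have le: "f (l *\<^sub>R x) $ i \<le> ennreal l * f x $ i" if x: "x \<in> E" and l: "0 < l" for x l i
    using pure[OF x]
  proof
    assume fin: "\<forall>i. f x $ i < \<infinity>"
    \<comment> \<open>Finiteness makes \<open>f x\<close> itself a real vector, the least one above
      \<open>x\<close>.\<close>
    have "(x, \<chi> i. enn2real (f x $ i)) \<in> epi E f"
      using x fin by (simp add: mem_epi_iff)
    from is_coneD[OF cone this l] have "f (l *\<^sub>R x) $ i \<le> ennreal (l * enn2real (f x $ i))"
      by (simp add: mem_epi_iff)
    then show ?thesis
      using l fin by (simp add: ennreal_mult)
  next
    assume "\<forall>i. f x $ i = \<infinity>"
    then show ?thesis
      using l by (simp add: ennreal_mult_top)
  qed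
  have ge: "ennreal l * f x $ i \<le> f (l *\<^sub>R x) $ i" if x: "x \<in> E" and l: "0 < l" for x l i
  proof -
    \<comment> \<open>Apply \<open>le\<close> at the point \<open>l *\<^sub>R x\<close> with factor
      \<open>inverse l\<close>, which leads back to \<open>x\<close>.\<close>
    have "f x $ i \<le> ennreal (inverse l) * f (l *\<^sub>R x) $ i"
      using le[OF is_coneD[OF assms(1) x l], of "inverse l" i] l by simp
    then have "ennreal l * f x $ i \<le> ennreal l * (ennreal (inverse l) * f (l *\<^sub>R x) $ i)"
      by (rule mult_left_mono) simp
    also have "\<dots> = ennreal (l * inverse l) * f (l *\<^sub>R x) $ i"
      using l by (simp add: ennreal_mult mult.assoc del: right_inverse)
    finally show ?thesis
      using l by simp
  qed
  show ?thesis
    unfolding positively_homogeneous_on_def vec_eq_iff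
    using le ge by (auto intro: antisym)
qed

theorem proposition2p5:
  fixes E :: "'a::ordered_real_vector set"
    and f :: "'a \<Rightarrow> ennreal ^ 'm"
  assumes "E \<subseteq> {x. 0 \<le> x}"
    and "is_cone E"
  shows "(positively_homogeneous_on E f \<longrightarrow> is_cone (epi E f))
       \<and> (is_cone (epi E f) \<longleftrightarrow> is_cone (geometric_epi E f))
       \<and> (CARD('m) = 1 \<or> (\<forall>x\<in>E. \<forall>i. f x $ i < \<infinity>) \<longrightarrow>
            is_cone (epi E f) \<longrightarrow> positively_homogeneous_on E f)"
proof (intro conjI impI)
  show "is_cone (epi E f)" if "positively_homogeneous_on E f"
    using is_cone_epi[OF assms(2) that] .
  show "is_cone (epi E f) \<longleftrightarrow> is_cone (geometric_epi E f)"
    using is_cone_geometric_epi is_cone_epi_if_geometric[OF assms(2)] by blast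
  assume finite: "CARD('m) = 1 \<or> (\<forall>x\<in>E. \<forall>i. f x $ i < \<infinity>)" and cone: "is_cone (epi E f)"
  show "positively_homogeneous_on E f"
  proof (rule positively_homogeneous_on_if_is_cone_epi[OF assms(2) cone])
    fix x
    assume "x \<in> E"
    show "(\<forall>i. f x $ i < \<infinity>) \<or> (\<forall>i. f x $ i = \<infinity>)"
      using finite
    proof
      \<comment> \<open>With a single coordinate, finite and infinite components cannot be
        mixed.\<close>
      assume "CARD('m) = 1"
      then obtain j :: 'm where "UNIV = {j}"
        by (rule card_1_singletonE)
      then have "i = j" for i
        by auto
      then show ?thesis
        by (metis infinity_ennreal_def less_top)
    qed (use \<open>x \<in> E\<close> in blast)
  qed
qed

end
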